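(* There are two deformations of the $\mathfrak{vect}(1)$-action on $\mathcal{S}^2_3=\mathcal{F}_3\oplus\mathcal{F}_2\oplus\mathcal{F}_1$ with three independent parameters $t_1,t_2,t_3$, given by $$\mathcal{L}_X=L_X+t_1\big(C_{1,1}(X)+C_{3,3}(X)\big)+t_2C_{2,2}(X)+t_3C_{1,3}(X)$$ or $$\mathcal{L}_X=L_X+t_1C_{1,1}(X)+t_2C_{2,2}(X)+t_3C_{3,3}(X).$$
   Context: $\mathfrak{vect}(1)$ is the Lie algebra of polynomial vector fields $X\frac{d}{dx}$, $X\in\mathbb{R}[x]$. $\mathcal{F}_\lambda=\{f\,dx^\lambda: f\in\mathbb{R}[x]\}$ with action $L^\lambda_X(f)=Xf'+\lambda X'f$; $L_X$ is the resulting action on $\mathcal{S}^2_3$. Set $C_{\lambda,\lambda}(X)(f)=X'f$ (a map $\mathcal{F}_\lambda\to\mathcal{F}_\lambda$) and $C_{1,3}(X)(f)=X^{(3)}f+2X''f'$ (a map $\mathcal{F}_1\to\mathcal{F}_3$), extended by $0$ to $\mathcal{S}^2_3$. The general infinitesimal deformation of $\mathcal{S}^2_3$ is $L_X+\mathcal{L}^{(1)}_X$ with $\mathcal{L}^{(1)}_X=(t_{1,1}C_{1,1}+t_{1,3}C_{1,3}+t_{2,2}C_{2,2}+t_{3,3}C_{3,3})(X)$. A (formal) deformation with parameters $t$ is a formal series $\mathcal{L}_X=L_X+\mathcal{L}_X^{(1)}+\mathcal{L}_X^{(2)}+\cdots$, with $\mathcal{L}^{(m)}$ homogeneous of degree $m$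 in $t$ with values in differential operators on $\mathcal{S}^2_3$, satisfying $[\mathcal{L}_X,\mathcal{L}_Y]=\mathcal{L}_{[X,Y]}$ in every order in $t$. The two listed deformations have first-order terms obtained from $\mathcal{L}^{(1)}$ by imposing one linear relation on the four parameters, leaving three independent ones. *)

theory Defs
  imports "HOL-Analysis.Analysis" "HOL-Computational_Algebra.Polynomial"
begin

text \<open>A polynomial stands both for a vector field \<open>X d/dx\<close> and for a density \<open>f dx^w\<close>
  in \<open>F_w\<close>.\<close>

definition vect_bracket :: "real poly \<Rightarrow> real poly \<Rightarrow> real poly" where
  "vect_bracket X Y = X * pderiv Y - pderiv X * Y"

definition density_action :: "real \<Rightarrow> real poly \<Rightarrow> real poly \<Rightarrow> real poly" where
  "density_action w X f = X * pderiv f + smult w (pderiv X * f)"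

text \<open>An element of \<open>F_3 \<oplus> F_2 \<oplus> F_1\<close> is a vector of polynomials in which coordinate \<open>k\<close>,
  for \<open>k = 1, 2, 3\<close>, is the component in \<open>F_k\<close>.\<close>

type_synonym symbols = "real poly ^ 3"

definition symbol_action :: "real poly \<Rightarrow> symbols \<Rightarrow> symbols" where
  "symbol_action X f =
     vector [density_action 1 X (f $ 1), density_action 2 X (f $ 2), density_action 3 X (f $ 3)]"

text \<open>\<open>extend_by_zero j k D\<close> extends \<open>D : F_j \<rightarrow> F_k\<close> by zero.\<close>

definition extend_by_zero :: "3 \<Rightarrow> 3 \<Rightarrow> (real poly \<Rightarrow> real poly) \<Rightarrow> symbols \<Rightarrow> symbols" where
  "extend_by_zero j k D f = axis k (D (f $ j))"

definition C_diag :: "3 \<Rightarrow> real poly \<Rightarrow> symbols \<Rightarrow> symbols" where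
  "C_diag k X = extend_by_zero k k (\<lambda>f. pderiv X * f)"

definition C13 :: "real poly \<Rightarrow> symbols \<Rightarrow> symbols" where
  "C13 X = extend_by_zero 1 3
     (\<lambda>f. (pderiv ^^ 3) X * f + smult 2 ((pderiv ^^ 2) X * pderiv f))"

definition symbol_scale :: "real \<Rightarrow> symbols \<Rightarrow> symbols" where
  "symbol_scale c f = [:c:] *s f"

definition diff_operator :: "(real poly \<Rightarrow> real poly) \<Rightarrow> bool" where
  "diff_operator D \<longleftrightarrow> (\<exists>(n::nat) a. \<forall>f. D f = (\<Sum>k\<le>n. a k * (pderiv ^^ k) f))"

definition symbol_diff_operator :: "(symbols \<Rightarrow> symbols) \<Rightarrow> bool" where
  "symbol_diff_operator T \<longleftrightarrow>
     (\<exists>D. (\<forall>i j. diff_operator (D i j)) \<and> (\<forall>f. T f = (\<chi> i. \<Sum>j\<in>UNIV. D i j (f $ j))))"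

definition vect_linear :: "(real poly \<Rightarrow> symbols \<Rightarrow> symbols) \<Rightarrow> bool" where
  "vect_linear c \<longleftrightarrow>
     (\<forall>X Y f. c (X + Y) f = c X f + c Y f) \<and> (\<forall>r X f. c (smult r X) f = symbol_scale r (c X f))"

text \<open>Linear maps from polynomial vector fields to differential operators, depending on
  parameters \<open>t\<close> in \<open>H\<close> as a homogeneous polynomial of degree \<open>m\<close>; \<open>c \<alpha>\<close> is the
  coefficient of the monomial \<open>t^\<alpha>\<close>. Values at \<open>t\<close> outside \<open>H\<close> are irrelevant.\<close>

definition homogeneous_cochain ::
  "(real ^ 'p) set \<Rightarrow> nat \<Rightarrow> (real ^ 'p \<Rightarrow> real poly \<Rightarrow> symbols \<Rightarrow> symbols) \<Rightarrow> bool" where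
  "homogeneous_cochain H m P \<longleftrightarrow>
     (\<exists>c :: ('p \<Rightarrow> nat) \<Rightarrow> real poly \<Rightarrow> symbols \<Rightarrow> symbols.
        (\<forall>\<alpha>. vect_linear (c \<alpha>) \<and> (\<forall>X. symbol_diff_operator (c \<alpha> X))) \<and>
        (\<forall>t\<in>H. \<forall>X f. P t X f =
           (\<Sum>\<alpha> | (\<Sum>i\<in>UNIV. \<alpha> i) = m. symbol_scale (\<Prod>i\<in>UNIV. (t $ i) ^ \<alpha> i) (c \<alpha> X f))))"

text \<open>\<open>L m\<close> is the term of degree \<open>m\<close> of a formal deformation of \<open>symbol_action\<close> whose
  parameters range over the linear subspace \<open>H\<close>. Since the reals are infinite, the terms, being
  polynomial in \<open>t\<close>, are determined by their values on \<open>H\<close>, and the last condition is the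
  homomorphism property in degree \<open>k\<close>.\<close>

definition formal_deformation ::
  "(real ^ 'p) set \<Rightarrow> (nat \<Rightarrow> real ^ 'p \<Rightarrow> real poly \<Rightarrow> symbols \<Rightarrow> symbols) \<Rightarrow> bool" where
  "formal_deformation H L \<longleftrightarrow>
     (\<forall>t\<in>H. L 0 t = symbol_action) \<and>
     (\<forall>m. homogeneous_cochain H m (L m)) \<and>
     (\<forall>k. \<forall>t\<in>H. \<forall>X Y f.
        (\<Sum>i\<le>k. L i t X (L (k - i) t Y f) - L i t Y (L (k - i) t X f))
          = L k t (vect_bracket X Y) f)"

text \<open>The formal series with terms \<open>L m\<close> is finite and has sum \<open>P\<close>.\<close>

definition finite_series_sum ::
  "(nat \<Rightarrow> real ^ 'p \<Rightarrow> real poly \<Rightarrow> symbols \<Rightarrow> symbols) \<Rightarrow>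
   (real ^ 'p \<Rightarrow> real poly \<Rightarrow> symbols \<Rightarrow> symbols) \<Rightarrow> bool" where
  "finite_series_sum L P \<longleftrightarrow>
     (\<exists>N. (\<forall>m>N. \<forall>t X f. L m t X f = 0) \<and> (\<forall>t X f. P t X f = (\<Sum>m\<le>N. L m t X f)))"

text \<open>The first-order term of the general infinitesimal deformation; the coordinates of \<open>t\<close> are
  \<open>t_{1,1}, t_{1,3}, t_{2,2}, t_{3,3}\<close> in this order.\<close>

definition infinitesimal :: "real ^ 4 \<Rightarrow> real poly \<Rightarrow> symbols \<Rightarrow> symbols" where
  "infinitesimal t X f =
     symbol_scale (t $ 1) (C_diag 1 X f) + symbol_scale (t $ 2) (C13 X f) +
     symbol_scale (t $ 3) (C_diag 2 X f) + symbol_scale (t $ 4) (C_diag 3 X f)"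

end

theory Submission
  imports Defs
begin

text \<open>
  Both families are deformations with no terms beyond the first order, because the operators
  \<open>infinitesimal t X\<close> commute among themselves as soon as \<open>t\<^sub>1\<^sub>3 (t\<^sub>3\<^sub>3 - t\<^sub>1\<^sub>1) = 0\<close>.
  Conversely, the degree-two equation says that \<open>t\<^sub>1\<^sub>3 (t\<^sub>3\<^sub>3 - t\<^sub>1\<^sub>1)\<close> times a fixed 2-cocycle with
  values in the operators from \<open>F\<^sub>1\<close> to \<open>F\<^sub>3\<close> is a coboundary. Two values of this
  cocycle suffice to see that it is not, so \<open>t\<^sub>1\<^sub>3 (t\<^sub>3\<^sub>3 - t\<^sub>1\<^sub>1)\<close> vanishes on the parameter
  hyperplane, which, being contained in a union of two hyperplanes, equals one of them.
\<close>

section \<open>Componentwise formulas for the operators on symbols\<close>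

lemma symbols_eq_iff:
  fixes f g :: symbols
  shows "f = g \<longleftrightarrow> f $ 1 = g $ 1 \<and> f $ 2 = g $ 2 \<and> f $ 3 = g $ 3"
  by (simp add: vec_eq_iff forall_3)

lemma symbol_scale_nth [simp]: "symbol_scale c f $ i = smult c (f $ i)"
  by (simp add: symbol_scale_def)

lemma smult_sum_right: "smult c (\<Sum>i\<in>I. p i) = (\<Sum>i\<in>I. smult c (p i))"
  by (simp add: poly_eq_iff coeff_sum sum_distrib_left)

lemma vector_4 [simp]:
  "(vector [x, y, z, w] :: 'a::zero ^ 4) $ 1 = x"
  "(vector [x, y, z, w] :: 'a::zero ^ 4) $ 2 = y"
  "(vector [x, y, z, w] :: 'a::zero ^ 4) $ 3 = z"
  "(vector [x, y, z, w] :: 'a::zero ^ 4) $ 4 = w"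
  unfolding vector_def by simp_all

lemma symbol_action_nth [simp]:
  "symbol_action X f $ 1 = density_action 1 X (f $ 1)"
  "symbol_action X f $ 2 = density_action 2 X (f $ 2)"
  "symbol_action X f $ 3 = density_action 3 X (f $ 3)"
  by (simp_all add: symbol_action_def)

lemma infinitesimal_nth [simp]:
  "infinitesimal t X f $ 1 = smult (t $ 1) (pderiv X * f $ 1)"
  "infinitesimal t X f $ 2 = smult (t $ 3) (pderiv X * f $ 2)"
  "infinitesimal t X f $ 3 = smult (t $ 4) (pderiv X * f $ 3) +
     smult (t $ 2) (pderiv (pderiv (pderiv X)) * f $ 1 + smult 2 (pderiv (pderiv X) * pderiv (f $ 1)))"
  by (simp_all add: infinitesimal_def C_diag_def C13_def extend_by_zero_def axis_def
      numeral_3_eq_3 numeral_2_eq_2)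

section \<open>Differential operators and linearity in the vector field\<close>

lemma symbol_diff_operator_first_order:
  assumes "\<And>f i. T f $ i = (\<Sum>j\<in>UNIV. p i j * f $ j + q i j * pderiv (f $ j))"
  shows "symbol_diff_operator T"
proof -
  have "diff_operator (\<lambda>f. p i j * f + q i j * pderiv f)" for i j
    unfolding diff_operator_def
    \<comment> \<open>The order bound is 1, so only the coefficients at \<open>k = 0\<close> and
      \<open>k = 1\<close> enter the sum.\<close>
    by (rule exI[of _ 1], rule exI[of _ "\<lambda>k. if k = 0 then p i j else q i j"]) simp
  then show ?thesis
    unfolding symbol_diff_operator_def using assms
    by (intro exI[of _ "\<lambda>i j f. p i j * f + q i j * pderiv f"]) (simp add: vec_eq_iff)
qed

lemma symbol_diff_operator_action: "symbol_diff_operator (symbol_action X)"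
proof (rule symbol_diff_operator_first_order)
  fix f i
  show "symbol_action X f $ i = (\<Sum>j\<in>UNIV.
      (if i = j then smult (if i = 1 then 1 else if i = 2 then 2 else 3) (pderiv X) else 0) * f $ j +
      (if i = j then X else 0) * pderiv (f $ j))"
    using exhaust_3[of i] by (auto simp: sum_3 density_action_def)
qed

lemma symbol_diff_operator_infinitesimal: "symbol_diff_operator (infinitesimal t X)"
proof (rule symbol_diff_operator_first_order)
  fix f i
  show "infinitesimal t X f $ i = (\<Sum>j\<in>UNIV.
      (if i = j then smult (if i = 1 then t $ 1 else if i = 2 then t $ 3 else t $ 4) (pderiv X)
       else if i = 3 \<and> j = 1 then smult (t $ 2) (pderiv (pderiv (pderiv X))) else 0) * f $ j +
      (if i = 3 \<and> j = 1 then smult (2 * t $ 2) (pderiv (pderiv X)) else 0) * pderiv (f $ j))"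
    using exhaust_3[of i] by (auto simp: sum_3 algebra_simps smult_add_right)
qed

lemma vect_linear_action: "vect_linear symbol_action"
  by (simp add: vect_linear_def symbols_eq_iff density_action_def pderiv_add pderiv_smult
      algebra_simps smult_add_right)

lemma vect_linear_infinitesimal: "vect_linear (infinitesimal t)"
  by (simp add: vect_linear_def symbols_eq_iff pderiv_add pderiv_smult algebra_simps smult_add_right)

lemma vect_linear_zero: "vect_linear (\<lambda>X f. 0)"
  by (simp add: vect_linear_def symbols_eq_iff)

lemma symbol_diff_operator_zero: "symbol_diff_operator (\<lambda>f. 0)"
  by (rule symbol_diff_operator_first_order[where p = "\<lambda>i j. 0" and q = "\<lambda>i j. 0"]) simp

section \<open>Identities in degrees zero, one and two\<close>

text \<open>This is the degree-one equation. For the diagonal terms it comes from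
  \<open>[X,Y]' = X Y'' - Y X''\<close>; the off-diagonal term is a 1-cocycle of vector fields with
  values in the operators from \<open>F_1\<close> to \<open>F_3\<close>.\<close>

lemma infinitesimal_cocycle:
  "symbol_action X (infinitesimal t Y f) - symbol_action Y (infinitesimal t X f) +
   (infinitesimal t X (symbol_action Y f) - infinitesimal t Y (symbol_action X f)) =
   infinitesimal t (vect_bracket X Y) f"
  by (simp add: symbols_eq_iff density_action_def vect_bracket_def pderiv_add pderiv_diff
      pderiv_mult pderiv_smult algebra_simps smult_add_right smult_diff_right numeral_poly)
    (simp add: poly_eq_iff algebra_simps)

lemma symbol_action_commutator:
  "symbol_action X (symbol_action Y f) - symbol_action Y (symbol_action X f) =
   symbol_action (vect_bracket X Y) f"
  by (simp add: symbols_eq_iff density_action_def vect_bracket_def pderiv_add pderiv_diff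
      pderiv_mult pderiv_smult algebra_simps smult_add_right smult_diff_right)

text \<open>The diagonal terms are multiplications and commute. The commutator has a single entry,
  from \<open>F_1\<close> to \<open>F_3\<close>: it sends \<open>f\<close> to
  \<open>t $ 2 * (t $ 4 - t $ 1)\<close> times
  \<open>(X' Y''' - X''' Y') f + 2 (X' Y'' - X'' Y') f'\<close>.\<close>

lemma infinitesimal_commute:
  assumes "t $ 2 = 0 \<or> t $ 1 = t $ 4"
  shows "infinitesimal t X (infinitesimal t Y f) = infinitesimal t Y (infinitesimal t X f)"
  using assms by (auto simp: symbols_eq_iff pderiv_add pderiv_mult pderiv_smult algebra_simps
      smult_add_right)

section \<open>Deformations whose series stops at the first order\<close>

definition affine_terms ::
  "(real ^ 'p \<Rightarrow> real poly \<Rightarrow> symbols \<Rightarrow> symbols) \<Rightarrow>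
   nat \<Rightarrow> real ^ 'p \<Rightarrow> real poly \<Rightarrow> symbols \<Rightarrow> symbols" where
  "affine_terms P m t =
     (if m = 0 then symbol_action else if m = 1 then P t else (\<lambda>X f. 0))"

lemma finite_series_sum_affine:
  assumes "\<And>t X f. Q t X f = symbol_action X f + P t X f"
  shows "finite_series_sum (affine_terms P) Q"
  unfolding finite_series_sum_def using assms
  by (intro exI[of _ 1]) (simp add: affine_terms_def)

text \<open>The monomials of degree one are the coordinates, which turns the sum over multi-indices
  into a sum over coordinates.\<close>

lemma multi_indices_1:
  "{\<alpha> :: 'p::finite \<Rightarrow> nat. (\<Sum>i\<in>UNIV. \<alpha> i) = 1} = range (\<lambda>j i. if i = j then 1 else 0)"
proof (intro equalityI subsetI)
  fix \<alpha> :: "'p \<Rightarrow> nat"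
  assume "\<alpha> \<in> {\<alpha>. (\<Sum>i\<in>UNIV. \<alpha> i) = 1}"
  then obtain j where "\<alpha> j = 1" "\<And>i. i \<noteq> j \<Longrightarrow> \<alpha> i = 0"
    by (auto simp: sum_eq_Suc0_iff)
  then have "\<alpha> = (\<lambda>i. if i = j then 1 else 0)"
    by auto
  then show "\<alpha> \<in> range (\<lambda>j i. if i = j then 1 else 0)"
    by blast
qed auto

lemma homogeneous_cochain_zero: "homogeneous_cochain H m (\<lambda>t X f. 0)"
  unfolding homogeneous_cochain_def
  by (rule exI[of _ "\<lambda>_ _ _. 0"])
    (simp add: vect_linear_zero symbol_diff_operator_zero symbols_eq_iff)

lemma homogeneous_cochain_const:
  assumes "vect_linear c" "\<And>X. symbol_diff_operator (c X)"
  shows "homogeneous_cochain H 0 (\<lambda>t. c)"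
proof -
  have "{\<alpha> :: 'a \<Rightarrow> nat. (\<Sum>i\<in>UNIV. \<alpha> i) = 0} = {\<lambda>_. 0}"
    by auto
  then show ?thesis
    unfolding homogeneous_cochain_def using assms
    by (intro exI[of _ "\<lambda>_. c"]) (simp add: symbols_eq_iff)
qed

lemma homogeneous_cochain_linear:
  fixes D :: "'p::finite \<Rightarrow> real poly \<Rightarrow> symbols \<Rightarrow> symbols"
  assumes "\<And>j. vect_linear (D j)" "\<And>j X. symbol_diff_operator (D j X)"
    and P: "\<And>t X f. P t X f = (\<Sum>j\<in>UNIV. symbol_scale (t $ j) (D j X f))"
  shows "homogeneous_cochain H 1 P"
  unfolding homogeneous_cochain_def
\<comment> \<open>\<open>SOME j. \<alpha> j = 1\<close> reads the variable off a degree-one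
  monomial. For other multi-indices it may be any index, which is harmless because every
  \<open>D j\<close> is admissible.\<close>
proof (intro exI[of _ "\<lambda>\<alpha>. D (SOME j. \<alpha> j = 1)"] conjI allI ballI)
  fix t :: "real ^ 'p" and X f
  have inj: "inj (\<lambda>(j::'p) i. if i = j then 1 else (0::nat))"
    by (auto simp: inj_def fun_eq_iff split: if_splits)
  have "(SOME k. (if k = j then 1 else (0::nat)) = 1) = j" for j :: 'p
    by (rule some_equality) (auto split: if_splits)
  moreover have "(\<Prod>i\<in>UNIV. (t $ i) ^ (if i = j then 1 else 0)) = t $ j" for j
    by (simp add: if_distrib[of "power _"] prod.delta cong: if_cong)
  ultimately show "P t X f = (\<Sum>\<alpha> | (\<Sum>i\<in>UNIV. \<alpha> i) = 1.
      symbol_scale (\<Prod>i\<in>UNIV. (t $ i) ^ \<alpha> i) (D (SOME j. \<alpha> j = 1) X f))"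
    unfolding multi_indices_1 P by (subst sum.reindex[OF inj]) (simp add: o_def)
qed (use assms in auto)

text \<open>Since \<open>infinitesimal\<close> is linear in its parameter, the images under
  \<open>A\<close> of the unit vectors supply the coefficients of the first-order cochain.\<close>

lemma infinitesimal_linear_expansion:
  fixes s :: "real ^ 'p::finite"
  assumes "linear A"
  shows "infinitesimal (A s) X f =
    (\<Sum>j\<in>UNIV. symbol_scale (s $ j) (infinitesimal (A (axis j 1)) X f))"
proof -
  have "A s = A (\<Sum>j\<in>UNIV. s $ j *\<^sub>R axis j 1)"
    using basis_expansion[of s] by (simp add: scalar_mult_eq_scaleR)
  also have "\<dots> = (\<Sum>j\<in>UNIV. s $ j *\<^sub>R A (axis j 1))"
    using assms by (simp add: linear_sum linear_scale)
  finally have A: "A s $ i = (\<Sum>j\<in>UNIV. s $ j * A (axis j 1) $ i)" for i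
    by simp
  show ?thesis
    by (simp add: symbols_eq_iff A smult_sum smult_add_right sum.distrib
        sum_distrib_right mult.assoc)
qed

text \<open>The equation in degree 0 is the action property, in degree 1 the cocycle identity, and
  in degree 2 the commutation, which is where the hypothesis on \<open>H\<close> enters. The map
  \<open>A\<close> allows both a three-parameter family and a hyperplane with its own
  coordinates.\<close>

lemma formal_deformation_affine:
  fixes A :: "real ^ 'p::finite \<Rightarrow> real ^ 4"
  assumes A: "linear A" and H: "\<And>t. t \<in> H \<Longrightarrow> A t $ 2 = 0 \<or> A t $ 1 = A t $ 4"
  shows "formal_deformation H (affine_terms (\<lambda>t. infinitesimal (A t)))"
  unfolding formal_deformation_def
proof (intro conjI allI ballI)
  fix m :: nat
  consider "m = 0" | "m = 1" | "m > 1"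
    by linarith
  then show "homogeneous_cochain H m (affine_terms (\<lambda>t. infinitesimal (A t)) m)"
  proof cases
    case 1
    then show ?thesis
      using homogeneous_cochain_const[OF vect_linear_action symbol_diff_operator_action, of H]
      by (simp add: affine_terms_def[abs_def])
  next
    case 2
    then show ?thesis
      using homogeneous_cochain_linear[OF vect_linear_infinitesimal
          symbol_diff_operator_infinitesimal infinitesimal_linear_expansion[OF A], of H]
      by (simp add: affine_terms_def[abs_def])
  next
    case 3
    then show ?thesis
      by (simp add: affine_terms_def[abs_def] homogeneous_cochain_zero)
  qed
next
  fix k :: nat and t X Y f
  assume t: "t \<in> H"
  let ?L = "affine_terms (\<lambda>t. infinitesimal (A t))"
  have zero: "symbol_action Z 0 = 0" "infinitesimal s Z 0 = 0" for Z s
    by (simp_all add: symbols_eq_iff density_action_def)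
  consider "k = 0" | "k = 1" | "k = 2" | "k > 2"
    by linarith
  then show "(\<Sum>i\<le>k. ?L i t X (?L (k - i) t Y f) - ?L i t Y (?L (k - i) t X f))
      = ?L k t (vect_bracket X Y) f"
  proof cases
    case 4
    \<comment> \<open>For \<open>k > 2\<close> the indices \<open>i\<close> and \<open>k - i\<close>
      cannot both be at most 1, so every product contains a zero term.\<close>
    have "(\<Sum>i\<le>k. ?L i t X (?L (k - i) t Y f) - ?L i t Y (?L (k - i) t X f)) = 0"
      using 4 by (intro sum.neutral) (auto simp: affine_terms_def zero)
    then show ?thesis
      using 4 by (simp add: affine_terms_def)
  qed (use symbol_action_commutator infinitesimal_cocycle[of X "A t" Y f]
        infinitesimal_commute[OF H[OF t], of X Y f]
      in \<open>auto simp: affine_terms_def zero numeral_2_eq_2\<close>)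
qed (simp add: affine_terms_def)

section \<open>The obstruction in degree two\<close>

text \<open>At a fixed parameter the cochain is a linear combination of its coefficients, and
  differential operators are linear over the reals. This makes the unknown degree-two term
  accessible to computation.\<close>

lemma homogeneous_cochain_imp_linear:
  assumes "homogeneous_cochain H m P" "t \<in> H"
  shows "vect_linear (P t)"
    and "P t X (f + g) = P t X f + P t X g"
    and "P t X (symbol_scale r f) = symbol_scale r (P t X f)"
proof -
  obtain c where c: "\<And>\<alpha>. vect_linear (c \<alpha>)" "\<And>\<alpha> X. symbol_diff_operator (c \<alpha> X)"
    and P: "\<And>X f. P t X f = (\<Sum>\<alpha> | (\<Sum>i\<in>UNIV. \<alpha> i) = m.
      symbol_scale (\<Prod>i\<in>UNIV. (t $ i) ^ \<alpha> i) (c \<alpha> X f))"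
    using assms unfolding homogeneous_cochain_def by blast
  have scale_add: "symbol_scale a (u + v) = symbol_scale a u + symbol_scale a v"
    and scale_scale: "symbol_scale a (symbol_scale b u) = symbol_scale b (symbol_scale a u)"
    for a b u v
    by (simp_all add: vec_eq_iff smult_add_right mult.commute)
  have scale_sum: "symbol_scale a (\<Sum>i\<in>I. u i) = (\<Sum>i\<in>I. symbol_scale a (u i))"
    for a u and I :: "('a \<Rightarrow> nat) set"
    by (simp add: vec_eq_iff smult_sum_right)
  have pderiv_pow: "(pderiv ^^ k) (p + q) = (pderiv ^^ k) p + (pderiv ^^ k) q"
    "(pderiv ^^ k) (smult r p) = smult r ((pderiv ^^ k) p)" for k and p q :: "real poly"
    by (induction k) (simp_all add: pderiv_add pderiv_smult)
  have op: "diff_operator D \<Longrightarrow> D (p + q) = D p + D q"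
    "diff_operator D \<Longrightarrow> D (smult r p) = smult r (D p)" for D p q
    unfolding diff_operator_def
    by (auto simp: pderiv_pow ring_distribs sum.distrib smult_sum_right)
  have lin: "c \<alpha> X (f + g) = c \<alpha> X f + c \<alpha> X g"
    "c \<alpha> X (symbol_scale r f) = symbol_scale r (c \<alpha> X f)" for \<alpha>
  proof -
    obtain D where D: "\<And>i j. diff_operator (D i j)"
      "\<And>f. c \<alpha> X f = (\<chi> i. \<Sum>j\<in>UNIV. D i j (f $ j))"
      using c(2)[of \<alpha> X] unfolding symbol_diff_operator_def by blast
    show "c \<alpha> X (f + g) = c \<alpha> X f + c \<alpha> X g"
      "c \<alpha> X (symbol_scale r f) = symbol_scale r (c \<alpha> X f)"
      by (simp_all add: D(2) vec_eq_iff op[OF D(1)] sum.distrib smult_sum_right)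
  qed
  show "vect_linear (P t)"
    using c(1) unfolding vect_linear_def P
    by (simp add: scale_add scale_sum scale_scale sum.distrib)
  show "P t X (f + g) = P t X f + P t X g"
    by (simp add: P lin scale_add sum.distrib)
  show "P t X (symbol_scale r f) = symbol_scale r (P t X f)"
    unfolding P lin scale_sum by (intro sum.cong refl scale_scale)
qed

lemma deformation_obstruction:
  assumes L: "formal_deformation H L" and t: "t \<in> H" and L1: "L 1 t = infinitesimal t"
  shows "t $ 2 = 0 \<or> t $ 1 = t $ 4"
proof -
  have hom: "homogeneous_cochain H 2 (L 2)" and L0: "L 0 t = symbol_action"
    and mc: "(\<Sum>i\<le>2. L i t X (L (2 - i) t Y f) - L i t Y (L (2 - i) t X f))
      = L 2 t (vect_bracket X Y) f" for X Y f
    using L t unfolding formal_deformation_def by blast+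
  \<comment> \<open>\<open>E\<close> is the entry from \<open>F_1\<close> to \<open>F_3\<close> of
    the degree-two term, the one place where the first-order terms fail to commute. As the
    undeformed action is diagonal, the equation for this entry involves no other entry of
    \<open>L 2\<close>.\<close>
  define E where "E X p = (L 2 t X (axis 1 p)) $ 3" for X p
  have E_vect: "E (smult r X) p = smult r (E X p)" for r X p
    using homogeneous_cochain_imp_linear(1)[OF hom t] by (simp add: E_def vect_linear_def)
  have E_smult: "E X (smult r p) = smult r (E X p)" for r X p
  proof -
    have "axis 1 (smult r p) = symbol_scale r (axis 1 p)"
      by (simp add: vec_eq_iff axis_def)
    then show ?thesis
      using homogeneous_cochain_imp_linear(3)[OF hom t] by (simp add: E_def)
  qed
  have action: "symbol_action X (axis 1 p) = axis 1 (density_action 1 X p)" for X p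
    by (simp add: symbols_eq_iff density_action_def axis_def)
  \<comment> \<open>The three groups on the left are the summands \<open>i = 0\<close>,
    \<open>i = 1\<close> and \<open>i = 2\<close> of the degree-two equation.\<close>
  have E: "density_action 3 X (E Y p) - density_action 3 Y (E X p)
      + (infinitesimal t X (infinitesimal t Y (axis 1 p)) $ 3
         - infinitesimal t Y (infinitesimal t X (axis 1 p)) $ 3)
      + (E X (density_action 1 Y p) - E Y (density_action 1 X p)) = E (vect_bracket X Y) p"
    for X Y p
    using arg_cong[OF mc[of X Y "axis 1 p"], of "\<lambda>f. f $ 3"]
    by (simp add: numeral_2_eq_2 E_def L0 L1[unfolded One_nat_def] action)
  text \<open>Evaluating the equation for \<open>(x, x\<^sup>3)\<close> on \<open>1\<close> and the one for \<open>(x, x\<^sup>2)\<close> on \<open>x\<close> at the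
    origin, all values of the cochain cancel except \<open>E(x)(x\<^sup>2)(0)\<close>, which occurs with the same
    factor in both, while the values of the cocycle differ.\<close>
  let ?e = "poly (E [:0, 1:] [:0, 0, 1:]) 0"
  have "3 * ?e + 6 * (t $ 2 * (t $ 4 - t $ 1)) = 0"
    using arg_cong[OF E[of "[:0, 1:]" "[:0, 0, 0, 1:]" 1], of "\<lambda>p. poly p 0"]
      E_smult[of "[:0,1:]" 3 "[:0,0,1:]"] E_vect[of 2 "[:0,0,0,1:]" 1]
    by (simp add: density_action_def vect_bracket_def pderiv_pCons axis_def algebra_simps one_pCons)
  moreover have "3 * ?e + 4 * (t $ 2 * (t $ 4 - t $ 1)) = 0"
    using arg_cong[OF E[of "[:0, 1:]" "[:0, 0, 1:]" "[:0, 1:]"], of "\<lambda>p. poly p 0"]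
      E_smult[of "[:0,1:]" 3 "[:0,0,1:]"] E_smult[of "[:0,0,1:]" 2 "[:0,1:]"]
    by (simp add: density_action_def vect_bracket_def pderiv_pCons axis_def algebra_simps one_pCons)
  ultimately have "t $ 2 * (t $ 4 - t $ 1) = 0"
    by linarith
  then show ?thesis
    by auto
qed

section \<open>Hyperplanes contained in a union of two hyperplanes\<close>

lemma hyperplane_subset_imp_eq:
  fixes a b :: "'a::real_inner"
  assumes "b \<noteq> 0" and sub: "{t. a \<bullet> t = 0} \<subseteq> {t. b \<bullet> t = 0}"
  shows "{t. a \<bullet> t = 0} = {t. b \<bullet> t = 0}"
proof (rule antisym[OF sub], rule subsetI, rule ccontr)
  fix k
  assume k: "k \<in> {t. b \<bullet> t = 0}" "k \<notin> {t. a \<bullet> t = 0}"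
  \<comment> \<open>Projecting \<open>b\<close> along \<open>k\<close> into the kernel of
    \<open>a\<close> leaves its product with \<open>b\<close> equal to \<open>b \<bullet> b\<close>,
    because \<open>b \<bullet> k = 0\<close>.\<close>
  have "a \<bullet> (b - ((a \<bullet> b) / (a \<bullet> k)) *\<^sub>R k) = 0"
    using k by (simp add: inner_diff_right)
  then have "b \<bullet> (b - ((a \<bullet> b) / (a \<bullet> k)) *\<^sub>R k) = 0"
    using sub by blast
  then show False
    using k \<open>b \<noteq> 0\<close> by (simp add: inner_diff_right)
qed

text \<open>A vector space is not the union of two proper subspaces: if \<open>u\<close> avoids one
  and \<open>v\<close> the other, then \<open>u + v\<close> avoids both.\<close>

lemma hyperplane_subset_Un:
  fixes a b c :: "'a::real_inner"
  assumes "b \<noteq> 0" "c \<noteq> 0" and sub: "\<And>t. a \<bullet> t = 0 \<Longrightarrow> b \<bullet> t = 0 \<or> c \<bullet> t = 0"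
  shows "{t. a \<bullet> t = 0} = {t. b \<bullet> t = 0} \<or> {t. a \<bullet> t = 0} = {t. c \<bullet> t = 0}"
proof (rule ccontr)
  assume "\<not> ?thesis"
  then obtain u v where "a \<bullet> u = 0" "b \<bullet> u \<noteq> 0" "a \<bullet> v = 0" "c \<bullet> v \<noteq> 0"
    using hyperplane_subset_imp_eq[of b a] hyperplane_subset_imp_eq[of c a] assms(1,2) by blast
  moreover from this have "c \<bullet> u = 0" "b \<bullet> v = 0"
    using sub by blast+
  ultimately show False
    using sub[of "u + v"] by (simp add: inner_add_right)
qed

text \<open>One linear relation on the four parameters is given by a nonzero normal
  \<open>a\<close>. The last conjunct makes "there are two" exact; it compares hyperplanes, so that
  rescaling \<open>a\<close> does not matter.\<close>

theorem proposition5p1: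
  shows
    "(\<exists>L :: nat \<Rightarrow> real ^ 3 \<Rightarrow> real poly \<Rightarrow> symbols \<Rightarrow> symbols.
        formal_deformation UNIV L \<and>
        (\<forall>t. L 1 t = infinitesimal (vector [t $ 1, t $ 3, t $ 2, t $ 1])) \<and>
        finite_series_sum L (\<lambda>t X f. symbol_action X f
          + symbol_scale (t $ 1) (C_diag 1 X f + C_diag 3 X f)
          + symbol_scale (t $ 2) (C_diag 2 X f)
          + symbol_scale (t $ 3) (C13 X f)))
     \<and>
     (\<exists>L :: nat \<Rightarrow> real ^ 3 \<Rightarrow> real poly \<Rightarrow> symbols \<Rightarrow> symbols.
        formal_deformation UNIV L \<and>
        (\<forall>t. L 1 t = infinitesimal (vector [t $ 1, 0, t $ 2, t $ 3])) \<and>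
        finite_series_sum L (\<lambda>t X f. symbol_action X f
          + symbol_scale (t $ 1) (C_diag 1 X f)
          + symbol_scale (t $ 2) (C_diag 2 X f)
          + symbol_scale (t $ 3) (C_diag 3 X f)))
     \<and>
     (\<forall>a :: real ^ 4. a \<noteq> 0 \<longrightarrow>
        (\<exists>L. formal_deformation {t. a \<bullet> t = 0} L \<and>
             (\<forall>t\<in>{t. a \<bullet> t = 0}. L 1 t = infinitesimal t))
        \<longleftrightarrow> {t. a \<bullet> t = 0} = {t. t $ 1 = t $ 4} \<or> {t. a \<bullet> t = 0} = {t. t $ 2 = 0})"
proof (intro conjI allI impI)
  \<comment> \<open>This parametrises the hyperplane on which the coefficients of
    \<open>C_diag 1\<close> and \<open>C_diag 3\<close> agree.\<close>
  let ?A = "\<lambda>t :: real ^ 3. vector [t $ 1, t $ 3, t $ 2, t $ 1] :: real ^ 4"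
  have "linear ?A"
    by (rule linearI) (simp_all add: vec_eq_iff forall_4)
  then show "\<exists>L :: nat \<Rightarrow> real ^ 3 \<Rightarrow> real poly \<Rightarrow> symbols \<Rightarrow> symbols.
        formal_deformation UNIV L \<and>
        (\<forall>t. L 1 t = infinitesimal (?A t)) \<and>
        finite_series_sum L (\<lambda>t X f. symbol_action X f
          + symbol_scale (t $ 1) (C_diag 1 X f + C_diag 3 X f)
          + symbol_scale (t $ 2) (C_diag 2 X f)
          + symbol_scale (t $ 3) (C13 X f))"
    by (intro exI[of _ "affine_terms (\<lambda>t. infinitesimal (?A t))"] conjI
        formal_deformation_affine finite_series_sum_affine)
      (simp_all add: affine_terms_def infinitesimal_def vec_eq_iff smult_add_right)
next
  \<comment> \<open>Here the coefficient of \<open>C13\<close> is set to zero.\<close>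
  let ?A = "\<lambda>t :: real ^ 3. vector [t $ 1, 0, t $ 2, t $ 3] :: real ^ 4"
  have "linear ?A"
    by (rule linearI) (simp_all add: vec_eq_iff forall_4)
  then show "\<exists>L :: nat \<Rightarrow> real ^ 3 \<Rightarrow> real poly \<Rightarrow> symbols \<Rightarrow> symbols.
        formal_deformation UNIV L \<and>
        (\<forall>t. L 1 t = infinitesimal (?A t)) \<and>
        finite_series_sum L (\<lambda>t X f. symbol_action X f
          + symbol_scale (t $ 1) (C_diag 1 X f)
          + symbol_scale (t $ 2) (C_diag 2 X f)
          + symbol_scale (t $ 3) (C_diag 3 X f))"
    by (intro exI[of _ "affine_terms (\<lambda>t. infinitesimal (?A t))"] conjI
        formal_deformation_affine finite_series_sum_affine)
      (simp_all add: affine_terms_def infinitesimal_def vec_eq_iff)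
next
  fix a :: "real ^ 4"
  let ?H = "{t. a \<bullet> t = 0}"
  let ?b = "axis 1 1 - axis 4 1 :: real ^ 4" and ?c = "axis 2 1 :: real ^ 4"
  have b: "{t. t $ 1 = t $ 4} = {t. ?b \<bullet> t = 0}" and c: "{t. t $ 2 = 0} = {t. ?c \<bullet> t = 0}"
    by (simp_all add: inner_diff_left inner_axis')
  show "(\<exists>L. formal_deformation ?H L \<and> (\<forall>t\<in>?H. L 1 t = infinitesimal t))
      \<longleftrightarrow> ?H = {t. t $ 1 = t $ 4} \<or> ?H = {t. t $ 2 = 0}"
  proof
    assume "\<exists>L. formal_deformation ?H L \<and> (\<forall>t\<in>?H. L 1 t = infinitesimal t)"
    then have "t $ 1 = t $ 4 \<or> t $ 2 = 0" if "a \<bullet> t = 0" for t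
      using deformation_obstruction that by blast
    moreover have "?b \<noteq> 0" "?c \<noteq> 0"
      by (simp_all add: axis_eq_axis)
    ultimately show "?H = {t. t $ 1 = t $ 4} \<or> ?H = {t. t $ 2 = 0}"
      unfolding b c using hyperplane_subset_Un[of ?b ?c a] b c by blast
  next
    assume "?H = {t. t $ 1 = t $ 4} \<or> ?H = {t. t $ 2 = 0}"
    then have "t $ 2 = 0 \<or> t $ 1 = t $ 4" if "t \<in> ?H" for t
      using that by blast
    \<comment> \<open>On a hyperplane the four coordinates themselves are the parameters, so the
      linear map is the identity.\<close>
    then have "formal_deformation ?H (affine_terms infinitesimal)"
      using formal_deformation_affine[of "\<lambda>t. t" ?H] by (simp add: linear_id[unfolded id_def])
    then show "\<exists>L. formal_deformation ?H L \<and> (\<forall>t\<in>?H. L 1 t = infinitesimal t)"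
      by (intro exI[of _ "affine_terms infinitesimal"]) (simp add: affine_terms_def)
  qed
qed

end
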